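(* Let $F(\mathbf x)\in\mathbb Q[\mathbf x^{\pm}]$ be a Laurent polynomial whose cluster symmetric set $\mathcal S(F)$ is nonempty. If there exists a seed $\Omega=(B,\mathbf x,R,\mathbf Z)$ such that for every $\psi_{\sigma,s,\omega_s}\in\mathcal S(F)$ one has $\sigma\mu_s\in\mathcal S(\Omega)$ and $\omega_s=\pi_s(\Omega^{\pm})$, then $\mathcal S(F)\subseteq\mathcal S(\Omega)$.
   Context: Fix $n\ge1$, indeterminates $\mathbf x=(x_1,\dots,x_n)$, $\mathcal F=\mathbb Q(x_1,\dots,x_n)$. For $\sigma\in\mathfrak S_n$, $\sigma(\mathbf v)=(v_{\sigma(1)},\dots,v_{\sigma(n)})$; $[a]_+=\max\{a,0\}$ componentwise; $\mathbf x^{\mathbf v}=\prod x_i^{v_i}$. Cluster symmetric maps. A seedlet at direction $s$ is $\omega_s=(\mathbf b,r,Z)$ with $\mathbf b\in\mathbb Z^n$, $b_s=0$, $r\in\mathbb Z_{>0}$, $Z(u)=\sum_{i=0}^r z_iu^i\in\mathbb Z_{\ge0}[u]$, $z_0,z_r>0$; its exchange polynomial is $P_{\omega_s}(\mathbf x)=\sum_{i=0}^r z_i\mathbf x^{i[\mathbf b]_++(r-i)[-\mathbf b]_+}$. For $\sigma\in\mathfrak S_n$ and $t=\sigma^{-1}(s)$, the cluster symmetric map $\psi_{\sigma,s,\omega_s}(\mathbf x)$ has $i$-th component $x_{\sigma(i)}$ for $i\ne t$ and $t$-th component $P_{\omega_s}(\mathbf x)/x_s$. $F$ is of type $\frac{\bm\eta}{\mathbf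 d}$ if $F=T/\mathbf x^{\mathbf d}$ with $T\in\mathbb Q[\mathbf x]$, $x_i\nmid T$ for all $i$, $\eta_i=$ degree of $T$ in $x_i$. Then $\mathcal S(F)=\{\psi_{\sigma,s,\omega_s}\mid F(\psi_{\sigma,s,\omega_s}(\mathbf x))=F(\mathbf x),\ \eta_s\ne0\}$. Seeds. A seed is $\Omega=(B,\mathbf x,R,\mathbf Z)$: $B=(b_{ij})$ an $n\times n$ skew-symmetrizable integer matrix; $\mathbf x$ an $n$-tuple of free generators of $\mathcal F$ (the cluster); $R=\mathrm{diag}(r_1,\dots,r_n)$ with positive integers $r_i$; $\mathbf Z=(Z_1,\dots,Z_n)$ with $Z_k(u)=\sum_{i=0}^{r_k}z_{k,i}u^i\in\mathbb Z_{\ge0}[u]$, $z_{k,i}=z_{k,r_k-i}$, $z_{k,0}=z_{k,r_k}=1$. Put $B_s=(b_{1s},\dots,b_{ns})$ and $P_{\Omega,s}(\mathbf x)=\sum_{i=0}^{r_s}z_{s,i}\mathbf x^{i[B_s]_++(r_s-i)[-B_s]_+}$. The mutation is $\mu_s(B,\mathbf x,R,\mathbf Z)=(B',\mathbf x',R,\mathbf Z)$ with $b'_{ij}=-b_{ij}$ if $i=s$ or $j=s$, $b'_{ij}=b_{ij}+r_s([b_{is}]_+b_{sj}+b_{is}[-b_{sj}]_+)$ otherwise, $x'_s=P_{\Omega,s}(\mathbf x)/x_s$, $x'_j=x_j$ for $j\neq s$. A permutation acts by $\sigma(B,\mathbf x,R,\mathbf Z)=((b_{\sigma(i)\sigma(j)}),\sigma(\mathbf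 x),\mathrm{diag}(r_{\sigma(i)}),\sigma(\mathbf Z))$, and $\sigma\mu_s$ means first $\mu_s$, then $\sigma$. Let $\mathcal S(\Omega)=\{\sigma\mu_s\mid \sigma\mu_s(B,\mathbf x,R,\mathbf Z)=(\pm B,\mathbf x',R,\mathbf Z) \text{ for some } \mathbf x',\ \sigma\in\mathfrak S_n,\ s\in[1,n]\}$. Let $\Omega^{\pm}=(\pm B,\mathbf x,R,\mathbf Z)$ and $\pi_s(\Omega)=(B_s,r_s,Z_s)$, a seedlet at direction $s$; "$\omega_s=\pi_s(\Omega^{\pm})$" means that $\omega_s$ equals $\pi_s(\Omega^{+})$ or $\pi_s(\Omega^{-})$. Convention. An element $\sigma\mu_s\in\mathcal S(\Omega)$ is identified with the transformation of clusters $\mathbf x\mapsto\sigma\mu_s(\mathbf x)$ it induces; the inclusion $\mathcal S(F)\subseteq\mathcal S(\Omega)$ is an inclusion of sets of such transformations. The elements of $\mathcal S(F)$ are maps, and the condition on $\psi_{\sigma,s,\omega_s}\in\mathcal S(F)$ is that the map can be presented by data $(\sigma,s,\omega_s)$ with the stated properties. *)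

theory Defs
  imports
    "HOL-Computational_Algebra.Computational_Algebra"
    "HOL-Library.Poly_Mapping"
begin

(* Indices range over a finite type 'n, so n = CARD('n) >= 1 is arbitrary.  The linear order on 'n
   serves only to make polynomials an instance of idom, as Fraction_Field requires. *)

type_synonym 'n mpoly = "('n \<Rightarrow>\<^sub>0 nat) \<Rightarrow>\<^sub>0 rat"
type_synonym 'n lpoly = "('n \<Rightarrow>\<^sub>0 int) \<Rightarrow>\<^sub>0 rat"
type_synonym 'n ratfun = "'n mpoly fract"
type_synonym 'n tuple = "'n \<Rightarrow> 'n ratfun"

definition var :: "'n::{finite,linorder} \<Rightarrow> 'n mpoly" where
  "var i = Poly_Mapping.single (Poly_Mapping.single i 1) 1"

definition of_const :: "rat \<Rightarrow> 'n::{finite,linorder} ratfun" where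
  "of_const c = to_fract (Poly_Mapping.single 0 c)"

definition indets :: "'n::{finite,linorder} tuple" where
  "indets i = to_fract (var i)"

definition vpow :: "'n::{finite,linorder} tuple \<Rightarrow> ('n \<Rightarrow> int) \<Rightarrow> 'n ratfun" where
  "vpow y v = (\<Prod>i\<in>UNIV. y i powi v i)"

definition mpoly_eval :: "'n::{finite,linorder} mpoly \<Rightarrow> 'n tuple \<Rightarrow> 'n ratfun" where
  "mpoly_eval p y = (\<Sum>m\<in>Poly_Mapping.keys p.
     of_const (Poly_Mapping.lookup p m) * vpow y (\<lambda>i. int (Poly_Mapping.lookup m i)))"

definition lpoly_eval :: "'n::{finite,linorder} lpoly \<Rightarrow> 'n tuple \<Rightarrow> 'n ratfun" where
  "lpoly_eval F y = (\<Sum>e\<in>Poly_Mapping.keys F.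
     of_const (Poly_Mapping.lookup F e) * vpow y (Poly_Mapping.lookup e))"

definition degree_in :: "'n::{finite,linorder} \<Rightarrow> 'n mpoly \<Rightarrow> nat" where
  "degree_in i T = Max ((\<lambda>m. Poly_Mapping.lookup m i) ` Poly_Mapping.keys T)"

(* The condition on T excludes T = 0, so 0 has no type; for F nonzero, eta and d are unique. *)
definition has_type ::
  "'n::{finite,linorder} lpoly \<Rightarrow> ('n \<Rightarrow> nat) \<Rightarrow> ('n \<Rightarrow> int) \<Rightarrow> bool" where
  "has_type F \<eta> d \<longleftrightarrow> (\<exists>T. lpoly_eval F indets = to_fract T / vpow indets d \<and>
     (\<forall>i. \<not> var i dvd T) \<and> (\<forall>i. \<eta> i = degree_in i T))"

definition pos_part :: "('n \<Rightarrow> int) \<Rightarrow> 'n \<Rightarrow> int" where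
  "pos_part v i = max (v i) 0"

definition neg_part :: "('n \<Rightarrow> int) \<Rightarrow> 'n \<Rightarrow> int" where
  "neg_part v i = max (- v i) 0"

definition exchange ::
  "('n \<Rightarrow> int) \<Rightarrow> nat \<Rightarrow> nat poly \<Rightarrow> 'n::{finite,linorder} tuple \<Rightarrow> 'n ratfun" where
  "exchange b r Z y = (\<Sum>i\<le>r. of_nat (coeff Z i) *
     vpow y (\<lambda>j. int i * pos_part b j + int (r - i) * neg_part b j))"

(* sigma(v) = (v_sigma(1), ..., v_sigma(n)) *)
definition perm_act :: "('n \<Rightarrow> 'n) \<Rightarrow> ('n \<Rightarrow> 'a) \<Rightarrow> 'n \<Rightarrow> 'a" where
  "perm_act \<sigma> v = (\<lambda>i. v (\<sigma> i))"


type_synonym 'n seedlet = "('n \<Rightarrow> int) \<times> nat \<times> nat poly"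

definition is_seedlet :: "'n \<Rightarrow> 'n seedlet \<Rightarrow> bool" where
  "is_seedlet s \<omega> \<longleftrightarrow> (case \<omega> of (b, r, Z) \<Rightarrow>
     b s = 0 \<and> r > 0 \<and> degree Z \<le> r \<and> coeff Z 0 > 0 \<and> coeff Z r > 0)"

definition seedlet_poly :: "'n::{finite,linorder} seedlet \<Rightarrow> 'n tuple \<Rightarrow> 'n ratfun" where
  "seedlet_poly \<omega> y = (case \<omega> of (b, r, Z) \<Rightarrow> exchange b r Z y)"

(* Rational transformations are taken as functions on all n-tuples over the field.  Division by a
   zero entry y s has the value 0, which is irrelevant on clusters.  No information is added outside
   the clusters: such a function is determined by its value at the tuple of indeterminates. *)
definition cluster_sym_map ::
  "('n \<Rightarrow> 'n) \<Rightarrow> 'n \<Rightarrow> 'n seedlet \<Rightarrow> 'n::{finite,linorder} tuple \<Rightarrow> 'n tuple" where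
  "cluster_sym_map \<sigma> s \<omega> y =
     (\<lambda>i. if i = inv \<sigma> s then seedlet_poly \<omega> y / y s else y (\<sigma> i))"

definition sym_set :: "'n::{finite,linorder} lpoly \<Rightarrow> ('n tuple \<Rightarrow> 'n tuple) set" where
  "sym_set F = {cluster_sym_map \<sigma> s \<omega> | \<sigma> s \<omega>.
     bij \<sigma> \<and> is_seedlet s \<omega> \<and>
     lpoly_eval F (cluster_sym_map \<sigma> s \<omega> indets) = lpoly_eval F indets \<and>
     (\<exists>\<eta> d. has_type F \<eta> d \<and> \<eta> s \<noteq> 0)}"


(* R is represented by its diagonal. *)
datatype 'n seed = Seed
  (exmat: "'n \<Rightarrow> 'n \<Rightarrow> int")
  (cluster: "'n tuple")
  (exdeg: "'n \<Rightarrow> nat")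
  (expoly: "'n \<Rightarrow> nat poly")

definition skew_symmetrizable :: "('n \<Rightarrow> 'n \<Rightarrow> int) \<Rightarrow> bool" where
  "skew_symmetrizable B \<longleftrightarrow>
     (\<exists>D :: 'n \<Rightarrow> int. (\<forall>i. D i > 0) \<and> (\<forall>i j. D i * B i j = - (D j * B j i)))"

definition free_generators :: "'n::{finite,linorder} tuple \<Rightarrow> bool" where
  "free_generators y \<longleftrightarrow>
     (\<forall>p. mpoly_eval p y = 0 \<longrightarrow> p = 0) \<and>
     (\<forall>f. \<exists>p q. mpoly_eval q y \<noteq> 0 \<and> f = mpoly_eval p y / mpoly_eval q y)"

definition is_seed :: "'n::{finite,linorder} seed \<Rightarrow> bool" where
  "is_seed \<Omega> \<longleftrightarrow> skew_symmetrizable (exmat \<Omega>) \<and> free_generators (cluster \<Omega>) \<and>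
     (\<forall>k. exdeg \<Omega> k > 0 \<and>
          degree (expoly \<Omega> k) \<le> exdeg \<Omega> k \<and>
          (\<forall>i \<le> exdeg \<Omega> k. coeff (expoly \<Omega> k) i = coeff (expoly \<Omega> k) (exdeg \<Omega> k - i)) \<and>
          coeff (expoly \<Omega> k) 0 = 1 \<and> coeff (expoly \<Omega> k) (exdeg \<Omega> k) = 1)"

definition column :: "'n seed \<Rightarrow> 'n \<Rightarrow> 'n \<Rightarrow> int" where
  "column \<Omega> s = (\<lambda>i. exmat \<Omega> i s)"

definition seed_poly :: "'n seed \<Rightarrow> 'n \<Rightarrow> 'n::{finite,linorder} tuple \<Rightarrow> 'n ratfun" where
  "seed_poly \<Omega> s y = exchange (column \<Omega> s) (exdeg \<Omega> s) (expoly \<Omega> s) y"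

definition mutate_mat :: "'n \<Rightarrow> nat \<Rightarrow> ('n \<Rightarrow> 'n \<Rightarrow> int) \<Rightarrow> 'n \<Rightarrow> 'n \<Rightarrow> int" where
  "mutate_mat s r B = (\<lambda>i j. if i = s \<or> j = s then - B i j
     else B i j + int r * (max (B i s) 0 * B s j + B i s * max (- B s j) 0))"

definition mutate :: "'n::{finite,linorder} \<Rightarrow> 'n seed \<Rightarrow> 'n seed" where
  "mutate s \<Omega> = Seed
     (mutate_mat s (exdeg \<Omega> s) (exmat \<Omega>))
     ((cluster \<Omega>)(s := seed_poly \<Omega> s (cluster \<Omega>) / cluster \<Omega> s))
     (exdeg \<Omega>)
     (expoly \<Omega>)"

definition perm_seed :: "('n \<Rightarrow> 'n) \<Rightarrow> 'n seed \<Rightarrow> 'n seed" where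
  "perm_seed \<sigma> \<Omega> = Seed
     (\<lambda>i j. exmat \<Omega> (\<sigma> i) (\<sigma> j))
     (perm_act \<sigma> (cluster \<Omega>))
     (perm_act \<sigma> (exdeg \<Omega>))
     (perm_act \<sigma> (expoly \<Omega>))"

definition neg_seed :: "'n seed \<Rightarrow> 'n seed" where
  "neg_seed \<Omega> = Seed (\<lambda>i j. - exmat \<Omega> i j) (cluster \<Omega>) (exdeg \<Omega>) (expoly \<Omega>)"

definition seedlet_of :: "'n \<Rightarrow> 'n seed \<Rightarrow> 'n seedlet" where
  "seedlet_of s \<Omega> = (column \<Omega> s, exdeg \<Omega> s, expoly \<Omega> s)"

(* The pair (sigma, s) stands for the operation "first mutate at s, then apply sigma". *)
definition seed_sym_set :: "'n::{finite,linorder} seed \<Rightarrow> (('n \<Rightarrow> 'n) \<times> 'n) set" where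
  "seed_sym_set \<Omega> = {(\<sigma>, s). bij \<sigma> \<and> (\<exists>x'.
     perm_seed \<sigma> (mutate s \<Omega>) = Seed (exmat \<Omega>) x' (exdeg \<Omega>) (expoly \<Omega>) \<or>
     perm_seed \<sigma> (mutate s \<Omega>) = Seed (\<lambda>i j. - exmat \<Omega> i j) x' (exdeg \<Omega>) (expoly \<Omega>))}"

definition cluster_transform ::
  "'n::{finite,linorder} seed \<Rightarrow> ('n \<Rightarrow> 'n) \<times> 'n \<Rightarrow> 'n tuple \<Rightarrow> 'n tuple" where
  "cluster_transform \<Omega> = (\<lambda>(\<sigma>, s) y.
     cluster (perm_seed \<sigma> (mutate s (Seed (exmat \<Omega>) y (exdeg \<Omega>) (expoly \<Omega>)))))"

end

theory Submission
  imports Defs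
begin

(* Replacing b by -b amounts to replacing Z by its reciprocal polynomial, and the polynomials Z_k
   of a seed are palindromic; so both seedlets of a direction give the same map, which is
   the one that the mutation induces on clusters. *)

lemma exchange_uminus:
  fixes y :: "'n::{finite,linorder} tuple"
  assumes "\<And>i. i \<le> r \<Longrightarrow> coeff Z i = coeff Z (r - i)"
  shows "exchange (\<lambda>j. - b j) r Z y = exchange b r Z y"
  unfolding exchange_def
\<comment> \<open>Negating \<open>b\<close> swaps \<open>pos_part\<close> and
  \<open>neg_part\<close>, so reversing the summation index matches the monomials; the symmetry of
  \<open>Z\<close> then matches the coefficients. Subtraction on naturals makes the reversal an
  involution only on \<open>{..r}\<close>.\<close>
proof (rule sum.reindex_bij_witness[where i = "\<lambda>i. r - i" and j = "\<lambda>i. r - i"])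
  fix i assume "i \<in> {..r}"
  then have "i \<le> r" by simp
  then have "r - (r - i) = i" by simp
  then show "of_nat (coeff Z (r - i)) *
        vpow y (\<lambda>j. int (r - i) * pos_part b j + int (r - (r - i)) * neg_part b j) =
      of_nat (coeff Z i) *
        vpow y (\<lambda>j. int i * pos_part (\<lambda>j. - b j) j + int (r - i) * neg_part (\<lambda>j. - b j) j)"
    using assms[OF \<open>i \<le> r\<close>] by (simp add: pos_part_def neg_part_def add.commute)
qed auto

lemma seedlet_poly_seedlet_of:
  "seedlet_poly (seedlet_of s \<Omega>) y = seed_poly \<Omega> s y"
  by (simp add: seedlet_poly_def seedlet_of_def seed_poly_def)

lemma seed_poly_neg_seed:
  assumes "is_seed \<Omega>"
  shows "seed_poly (neg_seed \<Omega>) s y = seed_poly \<Omega> s y"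
proof -
  have "coeff (expoly \<Omega> s) i = coeff (expoly \<Omega> s) (exdeg \<Omega> s - i)" if "i \<le> exdeg \<Omega> s" for i
    using assms that unfolding is_seed_def by blast
  from exchange_uminus[OF this] show ?thesis
    by (simp add: seed_poly_def neg_seed_def column_def)
qed

text \<open>Only the values of the exchange polynomial matter, which lets one lemma serve both signs
  of the seedlet. Both sides form the same quotient by \<open>y s\<close>, so they agree even where
  \<open>y s = 0\<close>.\<close>

lemma cluster_sym_map_eq_cluster_transform:
  assumes "bij \<sigma>" and "\<And>y. seedlet_poly \<omega> y = seed_poly \<Omega> s y"
  shows "cluster_sym_map \<sigma> s \<omega> = cluster_transform \<Omega> (\<sigma>, s)"
proof (intro ext)
  fix y i
  \<comment> \<open>The mutated variable sits at index \<open>s\<close> before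
    \<open>\<sigma>\<close> acts, hence at the position that \<open>\<sigma>\<close> sends to
    \<open>s\<close>.\<close>
  have "i = inv \<sigma> s \<longleftrightarrow> \<sigma> i = s"
    using \<open>bij \<sigma>\<close> by (metis bij_inv_eq_iff)
  then show "cluster_sym_map \<sigma> s \<omega> y i = cluster_transform \<Omega> (\<sigma>, s) y i"
    by (simp add: cluster_sym_map_def assms(2) cluster_transform_def perm_seed_def mutate_def
        perm_act_def seed_poly_def column_def)
qed

theorem proposition1p4:
  fixes F :: "'n::{finite,linorder} lpoly" and \<Omega> :: "'n seed"
  assumes "sym_set F \<noteq> {}"
    and "is_seed \<Omega>"
    and "\<forall>\<psi>\<in>sym_set F. \<exists>\<sigma> s \<omega>.
           bij \<sigma> \<and> is_seedlet s \<omega> \<and> \<psi> = cluster_sym_map \<sigma> s \<omega> \<and>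
           (\<sigma>, s) \<in> seed_sym_set \<Omega> \<and>
           (\<omega> = seedlet_of s \<Omega> \<or> \<omega> = seedlet_of s (neg_seed \<Omega>))"
  shows "sym_set F \<subseteq> cluster_transform \<Omega> ` seed_sym_set \<Omega>"
proof
  fix \<psi> assume "\<psi> \<in> sym_set F"
  \<comment> \<open>A map may have several presentations; the one taken here comes from the
    hypothesis on \<open>\<Omega>\<close>, not from the definition of
    \<open>sym_set\<close>.\<close>
  then obtain \<sigma> s \<omega> where *: "bij \<sigma>" "\<psi> = cluster_sym_map \<sigma> s \<omega>" "(\<sigma>, s) \<in> seed_sym_set \<Omega>"
    "\<omega> = seedlet_of s \<Omega> \<or> \<omega> = seedlet_of s (neg_seed \<Omega>)"
    using assms(3) by blast
  have "seedlet_poly \<omega> y = seed_poly \<Omega> s y" for y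
    using *(4) seed_poly_neg_seed[OF assms(2)] by (auto simp: seedlet_poly_seedlet_of)
  with *(1,2) have "\<psi> = cluster_transform \<Omega> (\<sigma>, s)"
    by (simp add: cluster_sym_map_eq_cluster_transform)
  with *(3) show "\<psi> \<in> cluster_transform \<Omega> ` seed_sym_set \<Omega>" by blast
qed

end
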